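(* Let $A=RB:I\to\mathbb{R}^{3\times6}$ be smooth on an open interval $I$, with columns linearly independent over $\mathbb{R}$ (as functions on $I$), where $R(t)\in SO(3)$ and $$B=\begin{pmatrix}b_{11}&b_{12}&b_{13}&\ell_2b_{12}&b_{13}/(\ell_1\ell_2)&\ell_1b_{11}\\0&b_{22}&b_{23}&\ell_2b_{22}&b_{23}/(\ell_1\ell_2)&0\\0&0&1/(b_{11}b_{22})&0&1/(\ell_1\ell_2b_{11}b_{22})&0\end{pmatrix}$$ with $b_{11},b_{22},\ell_1,\ell_2$ nowhere zero. Suppose that $$Q_{12},Q_{13},Q_{15},Q_{16},Q_{23},Q_{24},Q_{26},Q_{34},Q_{35},Q_{45},Q_{46},Q_{56}$$ are constant and that $\ell_2=1/(m_1\ell_1+m_0)$ for some real constants $m_0,m_1$. Then $R$ is constant and there are real constants $k_0,\dots,k_5$, with $k_0,k_1,k_2,m_0,m_1$ nonzero, such that $$(\ell_1')^3=k_0\,\ell_1^2(m_1\ell_1+m_0)^2,\qquad \ell_2=\frac1{m_1\ell_1+m_0},$$ $$b_{11}^3=\frac{k_1}{\ell_1(m_1\ell_1+m_0)},\qquad b_{22}=k_2b_{11}(m_1\ell_1+m_0),$$ $$b_{12}=k_3b_{11}(m_1\ell_1+m_0),\qquad b_{13}=k_4b_{11}\ell_1,\qquad b_{23}=k_5b_{11}\ell_1 .$$ Conversely, if $R$ is constant and these equations hold, then all the $Q_{ij}$ listed above are constant.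
   Context: For $A(t)\in\mathbb{R}^{3\times m}$ with columns $A_i$, $Q_{ij}=\langle A_i',A_j\rangle-\langle A_j',A_i\rangle$, $'=d/dt$. Origin: $\varphi(z,t)=A(t)v(z)$ is sought as a solution of the 3D incompressible Euler equations in Lagrangian form, with $v=(z_1,z_2,z_3,f_1(z_1),f_2(z_2),f_3(z_3))$, i.e. spatial constraints $dv^1\wedge dv^4=dv^2\wedge dv^5=dv^3\wedge dv^6=0$ (hyperbolic case, $m=6$). The matrix $B$ above is the $QR$ form of a time component whose minors $p_{ijk}=\det(A_i,A_j,A_k)$ satisfy $p_{123}=p_{456}=1$, $p_{126}=p_{135}=p_{156}=p_{234}=p_{246}=p_{345}=0$, where one has $A_6=\ell_1A_1$, $A_4=\ell_2A_2$, $A_5=A_3/(\ell_1\ell_2)$. Solutions with columns of $A$ linearly dependent over $\mathbb{R}$ are called reducible and discarded.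
   Formalization: The rotation factor R is also assumed to be smooth on I; if only A = RB is smooth, R may jump by sign changes absorbed into b_11 and b_22, and then R need not be constant. *)

theory Defs
  imports "HOL-Analysis.Analysis"
begin

text \<open>Derivatives are two-sided, so this is the usual notion of a $C^\infty$ function only for an
  open set \<open>I\<close>.\<close>

definition smooth_on :: "real set \<Rightarrow> (real \<Rightarrow> 'a::real_normed_vector) \<Rightarrow> bool" where
  "smooth_on I f \<longleftrightarrow>
     (\<forall>n. \<forall>t\<in>I. ((\<lambda>g s. vector_derivative g (at s)) ^^ n) f differentiable (at t))"

text \<open>Linear independence over the reals of the columns as vector-valued functions on \<open>I\<close>; at a
  single \<open>t\<close> the columns may well be dependent.\<close>

definition columns_independent_on :: "real set \<Rightarrow> (real \<Rightarrow> real^'m^'n) \<Rightarrow> bool" where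
  "columns_independent_on I A \<longleftrightarrow>
     (\<forall>c :: 'm \<Rightarrow> real.
        (\<forall>t\<in>I. (\<Sum>j\<in>UNIV. c j *\<^sub>R column j (A t)) = 0) \<longrightarrow> (\<forall>j. c j = 0))"

definition Q :: "(real \<Rightarrow> real^'m^'n) \<Rightarrow> 'm \<Rightarrow> 'm \<Rightarrow> real \<Rightarrow> real" where
  "Q A i j t =
     vector_derivative (\<lambda>s. column i (A s)) (at t) \<bullet> column j (A t)
     - vector_derivative (\<lambda>s. column j (A s)) (at t) \<bullet> column i (A t)"

definition B_matrix ::
  "real \<Rightarrow> real \<Rightarrow> real \<Rightarrow> real \<Rightarrow> real \<Rightarrow> real \<Rightarrow> real \<Rightarrow> real^6^3" where
  "B_matrix b11 b12 b13 b22 b23 l1 l2 = vector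
     [vector [b11, b12, b13, l2 * b12, b13 / (l1 * l2), l1 * b11],
      vector [0, b22, b23, l2 * b22, b23 / (l1 * l2), 0],
      vector [0, 0, 1 / (b11 * b22), 0, 1 / (l1 * l2 * b11 * b22), 0]]"

text \<open>The index type \<open>6\<close> is arithmetic modulo 6, so column 6 has index \<open>6 = 0\<close>. All pairs
  \<open>i < j\<close> occur except (1,4), (2,5), (3,6).\<close>

definition constrained_pairs :: "(6 \<times> 6) set" where
  "constrained_pairs =
     {(1,2), (1,3), (1,5), (1,6), (2,3), (2,4), (2,6), (3,4), (3,5), (4,5), (4,6), (5,6)}"

end

theory Submission
  imports Defs
begin

text \<open>
  Put \<open>x = l1\<close> and \<open>w = m1 * x + m0\<close>, so that \<open>l2 = 1 / w\<close>. Pulling out \<open>b11\<close>, the six columns are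
  the multiples \<open>1, w, x, 1, w, x\<close> of only three vectors \<open>V 1, V 2, V 3, V 2, V 3, V 1\<close>
  (\<open>column_A\<close>). The factors are affine in \<open>x\<close>, so for columns \<open>i, j\<close> with factors \<open>\<alpha>, \<beta>\<close> and
  directions \<open>a, b\<close> the form \<open>Q\<close> becomes (\<open>Q_eq\<close>)
    \<open>Q A i j = \<alpha> * \<beta> * twist a b + [\<alpha>, \<beta>] * pairing a b\<close>,
  where \<open>[\<alpha>, \<beta>]\<close> is the constant determinant of the coefficients of \<open>\<alpha>\<close> and \<open>\<beta>\<close>, while
  \<open>twist a b\<close> is \<open>b11\<^sup>2\<close> times the \<open>Q\<close>-form of \<open>V a, V b\<close>, and \<open>pairing a b\<close> is \<open>b11\<^sup>2 * x'\<close> times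
  their inner product.

  The constrained pairs split accordingly. The pairs (1,6), (2,4), (3,5) have \<open>a = b\<close>, hence no
  twist, and say that \<open>pairing a a\<close> is constant; the first of them, as \<open>V 1\<close> is a unit vector,
  says that \<open>b11\<^sup>2 * x'\<close> is constant. For each of the three choices of \<open>a \<noteq> b\<close> there remain three
  equations between the two functions \<open>twist a b\<close> and \<open>pairing a b\<close>. As \<open>x\<close> varies, they force the
  first to vanish and the second to be constant (\<open>bracket_triple_rigid\<close>). Linear independence of
  the columns ensures that \<open>x\<close> varies and that \<open>m0\<close> and \<open>m1\<close> are nonzero.

  Thus all inner products \<open>V a \<bullet> V b\<close> are constant, and the vanishing twist says
  \<open>V' a \<bullet> V b = V' b \<bullet> V a\<close>; with the product rule every \<open>V' a \<bullet> V b\<close> is zero, so the vectors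
  \<open>V a\<close> themselves are constant (\<open>V_constant\<close>). They are the columns of \<open>R U\<close> with \<open>U\<close> upper
  triangular, so Gram-Schmidt makes \<open>R\<close> and \<open>U\<close> constant (\<open>QR_factors_constant\<close>). The
  constants \<open>k2, \<dots>, k5\<close> are entries of \<open>U\<close>; \<open>k1\<close> comes from its last diagonal entry, and \<open>k0\<close> from
  the constancy of \<open>b11\<^sup>2 * x'\<close>.

  Conversely, the stated equations make \<open>R\<close>, \<open>U\<close> and \<open>b11\<^sup>2 * x'\<close> constant, so that all twists
  vanish, all pairings are constant, and \<open>Q_eq\<close> finishes the proof.
\<close>

section \<open>Constant functions on an open interval\<close>

lemma constant_onI: "(\<And>t. t \<in> I \<Longrightarrow> f t = c) \<Longrightarrow> f constant_on I"
  by (auto simp: constant_on_def)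

lemma constant_on_if_derivative_zero:
  assumes "convex I" "\<And>t. t \<in> I \<Longrightarrow> (f has_vector_derivative 0) (at t)"
  shows "f constant_on I"
  using has_vector_derivative_zero_constant[of I f] assms has_vector_derivative_at_within
  by (metis constant_onI)

lemma derivative_zero_if_constant_on:
  assumes "open I" "t \<in> I" "f constant_on I"
  shows "(f has_vector_derivative 0) (at t)"
proof -
  obtain c where "\<And>s. s \<in> I \<Longrightarrow> f s = c"
    using assms(3) by (auto simp: constant_on_def)
  then show ?thesis
    using has_vector_derivative_transform_within_open[OF has_vector_derivative_const assms(1,2)]
    by metis
qed

lemma differentiable_transform_open:
  assumes "f differentiable (at t)" "open I" "t \<in> I" "\<And>s. s \<in> I \<Longrightarrow> f s = g s"
  shows "g differentiable (at t)"
  using assms has_derivative_transform_within_open unfolding differentiable_def by blast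

text \<open>One step of Gram-Schmidt: the factors of a constant vector \<open>f *\<^sub>R u\<close> with \<open>u\<close> of unit length are
  determined up to a common sign, and that sign cannot jump. Indeed \<open>f = v \<bullet> u\<close> is
  differentiable, and \<open>f\<^sup>2\<close> being constant gives \<open>2 * f * f' = 0\<close>.\<close>

lemma unit_direction_constant:
  fixes u :: "real \<Rightarrow> 'a::euclidean_space"
  assumes I: "open I" "convex I"
    and u: "\<And>t. t \<in> I \<Longrightarrow> u differentiable (at t)" "\<And>t. t \<in> I \<Longrightarrow> norm (u t) = 1"
    and f: "\<And>t. t \<in> I \<Longrightarrow> f t \<noteq> (0::real)"
    and v: "\<And>t. t \<in> I \<Longrightarrow> f t *\<^sub>R u t = v"
  shows "f constant_on I" "u constant_on I"
proof -
  have fu: "v \<bullet> u t = f t" if "t \<in> I" for t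
    using u(2)[OF that] v[OF that, symmetric] by (simp add: dot_square_norm)
  have sq: "(f t)\<^sup>2 = v \<bullet> v" if "t \<in> I" for t
    using u(2)[OF that] v[OF that, symmetric] by (simp add: dot_square_norm power2_eq_square)
  show fc: "f constant_on I"
  proof (rule constant_on_if_derivative_zero[OF I(2)])
    fix t assume t: "t \<in> I"
    define f' where "f' = v \<bullet> vector_derivative u (at t)"
    have "((\<lambda>s. v \<bullet> u s) has_vector_derivative f') (at t)"
      unfolding f'_def using u(1)[OF t]
      by (intro bounded_linear.has_vector_derivative[OF bounded_linear_inner_right])
        (simp add: vector_derivative_works)
    then have d: "(f has_vector_derivative f') (at t)"
      using has_vector_derivative_transform_within_open[OF _ I(1) t] fu by blast
    have "((\<lambda>s. f s * f s) has_vector_derivative f t * f' + f' * f t) (at t)"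
      by (rule has_vector_derivative_mult[OF d d])
    moreover have "((\<lambda>s. f s * f s) has_vector_derivative 0) (at t)"
      by (rule derivative_zero_if_constant_on[OF I(1) t])
        (rule constant_onI[where c = "v \<bullet> v"], simp add: sq[symmetric] power2_eq_square)
    ultimately have "f t * f' + f' * f t = 0"
      by (rule vector_derivative_unique_at)
    then show "(f has_vector_derivative 0) (at t)"
      using d f[OF t] by simp
  qed
  then obtain k where "\<And>t. t \<in> I \<Longrightarrow> f t = k"
    by (auto simp: constant_on_def)
  then show "u constant_on I"
    using v f by (intro constant_onI[where c = "(1 / k) *\<^sub>R v"]) fastforce
qed

section \<open>Brackets of affine functions\<close>

text \<open>Let \<open>\<alpha>, \<beta>, \<gamma>\<close> be pairwise independent affine functions of \<open>x\<close>, and \<open>[\<alpha>, \<beta>]\<close> the determinant of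
  the coefficients. The three equations belong to the pairs \<open>\<alpha>\<beta>\<close>, \<open>\<beta>\<gamma>\<close>, \<open>\<alpha>\<gamma>\<close> of a transitive
  ordering. Eliminating \<open>H\<close> from the first and third and using the Pluecker relation
  \<open>[\<alpha>, \<gamma>] * \<beta> - [\<alpha>, \<beta>] * \<gamma> = [\<beta>, \<gamma>] * \<alpha>\<close> leaves \<open>q * \<alpha>\<^sup>2\<close> constant; likewise the last two give
  \<open>q * \<gamma>\<^sup>2\<close> constant. Since \<open>\<alpha>\<close> and \<open>\<gamma>\<close> are not proportional and \<open>x\<close> moves, both constants, and
  hence \<open>q\<close>, must be zero.\<close>

lemma bracket_triple_rigid:
  fixes x q H :: "real \<Rightarrow> real"
  assumes I: "open I"
    and x: "\<And>t. t \<in> I \<Longrightarrow> (x has_real_derivative x' t) (at t)" "\<And>t. t \<in> I \<Longrightarrow> x' t \<noteq> 0"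
    and nz: "\<And>t. t \<in> I \<Longrightarrow> p1 * x t + r1 \<noteq> 0" "\<And>t. t \<in> I \<Longrightarrow> p3 * x t + r3 \<noteq> 0"
    and D: "p1 * r2 - r1 * p2 \<noteq> 0" "p2 * r3 - r2 * p3 \<noteq> 0" "p1 * r3 - r1 * p3 \<noteq> 0"
    and E12: "\<And>t. t \<in> I \<Longrightarrow>
        (p1 * x t + r1) * (p2 * x t + r2) * q t + (p1 * r2 - r1 * p2) * H t = c12"
    and E23: "\<And>t. t \<in> I \<Longrightarrow>
        (p2 * x t + r2) * (p3 * x t + r3) * q t + (p2 * r3 - r2 * p3) * H t = c23"
    and E13: "\<And>t. t \<in> I \<Longrightarrow>
        (p1 * x t + r1) * (p3 * x t + r3) * q t + (p1 * r3 - r1 * p3) * H t = c13"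
  shows "\<And>t. t \<in> I \<Longrightarrow> q t = 0" "H constant_on I"
proof -
  define e where "e = ((p1 * r3 - r1 * p3) * c12 - (p1 * r2 - r1 * p2) * c13) / (p2 * r3 - r2 * p3)"
  define f where "f = ((p1 * r3 - r1 * p3) * c23 - (p2 * r3 - r2 * p3) * c13) / (p1 * r2 - r1 * p2)"
  have e: "q t * (p1 * x t + r1)\<^sup>2 = e" if t: "t \<in> I" for t
  proof -
    have "(p2 * r3 - r2 * p3) * (q t * (p1 * x t + r1)\<^sup>2)
        = (p1 * r3 - r1 * p3) * c12 - (p1 * r2 - r1 * p2) * c13"
      unfolding E12[OF t, symmetric] E13[OF t, symmetric] by algebra
    then show ?thesis
      using D(2) by (simp add: e_def field_simps)
  qed
  have f: "q t * (p3 * x t + r3)\<^sup>2 = f" if t: "t \<in> I" for t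
  proof -
    have "(p1 * r2 - r1 * p2) * (q t * (p3 * x t + r3)\<^sup>2)
        = (p1 * r3 - r1 * p3) * c23 - (p2 * r3 - r2 * p3) * c13"
      unfolding E23[OF t, symmetric] E13[OF t, symmetric] by algebra
    then show ?thesis
      using D(1) by (simp add: f_def field_simps)
  qed
  have q0: "q t = 0" if t: "t \<in> I" for t
  proof -
    let ?g = "\<lambda>s. f * (p1 * x s + r1)\<^sup>2 - e * (p3 * x s + r3)\<^sup>2"
    have g: "?g s = 0" if "s \<in> I" for s
      unfolding e[OF that, symmetric] f[OF that, symmetric] by algebra
    have "(?g has_vector_derivative 0) (at t)"
      by (rule derivative_zero_if_constant_on[OF I t]) (rule constant_onI[OF g])
    moreover have "(?g has_real_derivative
        (2 * f * p1 * (p1 * x t + r1) - 2 * e * p3 * (p3 * x t + r3)) * x' t) (at t)"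
      by (auto intro!: derivative_eq_intros x(1)[OF t] simp: algebra_simps)
    ultimately have "(2 * f * p1 * (p1 * x t + r1) - 2 * e * p3 * (p3 * x t + r3)) * x' t = 0"
      using DERIV_unique has_real_derivative_iff_has_vector_derivative by blast
    then have d: "f * p1 * (p1 * x t + r1) = e * p3 * (p3 * x t + r3)"
      using x(2)[OF t] by simp
    \<comment> \<open>With \<open>\<alpha>\<close>, \<open>\<gamma>\<close> the two affine factors, \<open>g\<close> says \<open>f \<alpha>\<^sup>2 = e \<gamma>\<^sup>2\<close> and \<open>d\<close> is its derivative divided by \<open>2 x'\<close>;
      multiplying \<open>d\<close> by \<open>\<gamma>\<close> eliminates \<open>e\<close>, and \<open>p1 \<gamma> - p3 \<alpha>\<close> does not depend on \<open>x\<close>.\<close>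
    have "f * (p1 * x t + r1) * (p1 * r3 - r1 * p3) = 0"
      using d g[OF t] by algebra
    then have "f = 0"
      using nz(1)[OF t] D(3) by simp
    then show ?thesis
      using f[OF t] nz(2)[OF t] by simp
  qed
  show "q t = 0" if "t \<in> I" for t
    using that by (rule q0)
  show "H constant_on I"
    using D(1) E12 q0 by (intro constant_onI[where c = "c12 / (p1 * r2 - r1 * p2)"]) (force simp: field_simps)
qed

section \<open>Columns as multiples of three directions\<close>

lemma exhaust_6:
  fixes x :: 6
  shows "x = 1 \<or> x = 2 \<or> x = 3 \<or> x = 4 \<or> x = 5 \<or> x = 6"
proof (induct x)
  case (of_int z)
  then have "0 \<le> z" and "z < 6" by simp_all
  then have "z = 0 \<or> z = 1 \<or> z = 2 \<or> z = 3 \<or> z = 4 \<or> z = 5" by arith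
  then show ?case by auto
qed

lemma forall_6: "(\<forall>i::6. P i) \<longleftrightarrow> P 1 \<and> P 2 \<and> P 3 \<and> P 4 \<and> P 5 \<and> P 6"
  by (metis exhaust_6)

lemma vector_6:
  "(vector [a, b, c, d, e, f] :: 'a::zero^6) $ 1 = a"
  "(vector [a, b, c, d, e, f] :: 'a::zero^6) $ 2 = b"
  "(vector [a, b, c, d, e, f] :: 'a::zero^6) $ 3 = c"
  "(vector [a, b, c, d, e, f] :: 'a::zero^6) $ 4 = d"
  "(vector [a, b, c, d, e, f] :: 'a::zero^6) $ 5 = e"
  "(vector [a, b, c, d, e, f] :: 'a::zero^6) $ 6 = f"
  unfolding vector_def by simp_all

lemma bounded_linear_column: "bounded_linear (column j :: real^'m^'n \<Rightarrow> real^'n)"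
  by (simp add: linear_conv_bounded_linear[symmetric] linear_iff column_def vec_eq_iff)

lemma column_matrix_mult:
  fixes M :: "real^'k^'n" and N :: "real^'m^'k"
  shows "column j (M ** N) = (\<Sum>k\<in>UNIV. N $ k $ j *\<^sub>R column k M)"
  by (simp add: vec_eq_iff column_def matrix_matrix_mult_def mult.commute)

lemma Q_antisym: "Q A j i t = - Q A i j t"
  by (simp add: Q_def)

lemma proportional_columns_dependent:
  assumes "i \<noteq> j" "\<And>t. t \<in> I \<Longrightarrow> column i (A t) = k *\<^sub>R column j (A t)"
  shows "\<not> columns_independent_on I A"
proof
  assume ind: "columns_independent_on I A"
  define c where "c = (\<lambda>m. if m = i then 1 else if m = j then - k else 0)"
  have "(\<Sum>m\<in>UNIV. c m *\<^sub>R column m (A t)) = 0" if t: "t \<in> I" for t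
  proof -
    have "(\<Sum>m\<in>UNIV. c m *\<^sub>R column m (A t)) = (\<Sum>m\<in>{i, j}. c m *\<^sub>R column m (A t))"
      by (rule sum.mono_neutral_right) (auto simp: c_def)
    also have "\<dots> = 0"
      using assms(1) assms(2)[OF t] by (simp add: c_def)
    finally show ?thesis .
  qed
  then have "c i = 0"
    using ind unfolding columns_independent_on_def by blast
  then show False
    by (simp add: c_def)
qed

text \<open>Columns 6, 4, 5 are multiples of columns 1, 2, 3 respectively; \<open>dir\<close> records which of the three lines
  a column lies on.\<close>

definition dir :: "6 \<Rightarrow> 3" where
  "dir j = (if j = 1 \<or> j = 6 then 1 else if j = 2 \<or> j = 4 then 2 else 3)"

locale factored_solution =
  fixes I :: "real set"
    and A :: "real \<Rightarrow> real^6^3"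
    and R :: "real \<Rightarrow> real^3^3"
    and b11 b12 b13 b22 b23 l1 l2 :: "real \<Rightarrow> real"
    and m0 m1 :: real
  assumes open_I: "open I" and convex_I: "convex I"
    and A_differentiable: "\<And>t. t \<in> I \<Longrightarrow> A differentiable (at t)"
    and R_differentiable: "\<And>t. t \<in> I \<Longrightarrow> R differentiable (at t)"
    and R_orthogonal: "\<And>t. t \<in> I \<Longrightarrow> orthogonal_matrix (R t)"
    and A_eq: "\<And>t. t \<in> I \<Longrightarrow>
      A t = R t ** B_matrix (b11 t) (b12 t) (b13 t) (b22 t) (b23 t) (l1 t) (l2 t)"
    and nonzero: "\<And>t. t \<in> I \<Longrightarrow> b11 t \<noteq> 0" "\<And>t. t \<in> I \<Longrightarrow> b22 t \<noteq> 0"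
      "\<And>t. t \<in> I \<Longrightarrow> l1 t \<noteq> 0" "\<And>t. t \<in> I \<Longrightarrow> l2 t \<noteq> 0"
    and l2_eq: "\<And>t. t \<in> I \<Longrightarrow> l2 t = 1 / (m1 * l1 t + m0)"
begin

text \<open>\<open>factor j\<close> is the affine function \<open>1\<close>, \<open>w\<close> or \<open>x\<close> of \<open>x = l1\<close> that scales column \<open>j\<close> beyond \<open>b11\<close>.
  Column 4 is \<open>1 / w\<close> times column 2, and column 5 is \<open>w / x\<close> times column 3, so giving columns 2
  and 3 the factors \<open>w\<close> and \<open>x\<close> clears the denominators.\<close>

definition slope :: "6 \<Rightarrow> real" where
  "slope j = (if j = 2 \<or> j = 5 then m1 else if j = 3 \<or> j = 6 then 1 else 0)"

definition offset :: "6 \<Rightarrow> real" where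
  "offset j = (if j = 2 \<or> j = 5 then m0 else if j = 3 \<or> j = 6 then 0 else 1)"

definition factor :: "6 \<Rightarrow> real \<Rightarrow> real" where
  "factor j t = slope j * l1 t + offset j"

definition bracket :: "6 \<Rightarrow> 6 \<Rightarrow> real" where
  "bracket i j = slope i * offset j - offset i * slope j"

text \<open>The triangular factor of columns 1, 2, 3 after division by \<open>b11\<close> and by the factors \<open>1, w, x\<close>. Its
  entries are the functions that the theorem claims to be constant.\<close>

definition U :: "real \<Rightarrow> real^3^3" where
  "U t = vector
     [vector [1, b12 t / (b11 t * (m1 * l1 t + m0)), b13 t / (b11 t * l1 t)],
      vector [0, b22 t / (b11 t * (m1 * l1 t + m0)), b23 t / (b11 t * l1 t)],
      vector [0, 0, 1 / ((b11 t)\<^sup>2 * b22 t * l1 t)]]"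

definition V :: "3 \<Rightarrow> real \<Rightarrow> real^3" where
  "V a t = column a (R t ** U t)"

definition V' :: "3 \<Rightarrow> real \<Rightarrow> real^3" where
  "V' a t = vector_derivative (V a) (at t)"

text \<open>The two parts of \<open>Q\<close> on multiples of \<open>V a\<close> and \<open>V b\<close>: one carries the derivatives of the directions,
  the other those of the scalar factors.\<close>

definition twist :: "3 \<Rightarrow> 3 \<Rightarrow> real \<Rightarrow> real" where
  "twist a b t = (b11 t)\<^sup>2 * (V' a t \<bullet> V b t - V' b t \<bullet> V a t)"

definition pairing :: "3 \<Rightarrow> 3 \<Rightarrow> real \<Rightarrow> real" where
  "pairing a b t = (b11 t)\<^sup>2 * deriv l1 t * (V a t \<bullet> V b t)"

lemma w_nonzero: "t \<in> I \<Longrightarrow> m1 * l1 t + m0 \<noteq> 0"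
  using l2_eq[of t] nonzero(4)[of t] by auto

lemma factor_nonzero: "t \<in> I \<Longrightarrow> factor j t \<noteq> 0"
  using w_nonzero nonzero(3) by (simp add: factor_def slope_def offset_def)

lemma V_eq: "V a t = (\<Sum>k\<in>UNIV. U t $ k $ a *\<^sub>R column k (R t))"
  by (simp add: V_def column_matrix_mult)

lemma V_1: "V 1 t = column 1 (R t)"
  by (simp add: V_eq sum_3 U_def)

lemma V_2: "V 2 t = U t $ 1 $ 2 *\<^sub>R column 1 (R t) + U t $ 2 $ 2 *\<^sub>R column 2 (R t)"
  by (simp add: V_eq sum_3 U_def)

lemma V_3: "V 3 t = U t $ 1 $ 3 *\<^sub>R column 1 (R t) + U t $ 2 $ 3 *\<^sub>R column 2 (R t)
    + U t $ 3 $ 3 *\<^sub>R column 3 (R t)"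
  by (simp add: V_eq sum_3)

lemma U_diagonal: "t \<in> I \<Longrightarrow> U t $ 2 $ 2 \<noteq> 0" "t \<in> I \<Longrightarrow> U t $ 3 $ 3 \<noteq> 0"
  using nonzero w_nonzero by (simp_all add: U_def)

lemma column_A:
  assumes t: "t \<in> I"
  shows "column j (A t) = (b11 t * factor j t) *\<^sub>R V (dir j) t"
proof -
  let ?B = "B_matrix (b11 t) (b12 t) (b13 t) (b22 t) (b23 t) (l1 t) (l2 t)"
  define w where "w = m1 * l1 t + m0"
  have "\<forall>j k. ?B $ k $ j = b11 t * factor j t * U t $ k $ dir j"
    using nonzero(1-3)[OF t] w_nonzero[OF t]
    by (simp add: forall_3 forall_6 B_matrix_def vector_6 U_def dir_def factor_def slope_def
        offset_def l2_eq[OF t] flip: w_def) (simp add: field_simps power2_eq_square)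
  then show ?thesis
    by (simp add: A_eq[OF t] column_matrix_mult V_eq scaleR_sum_right)
qed

lemma R_columns:
  assumes "t \<in> I"
  shows "column i (R t) \<bullet> column j (R t) = (if i = j then 1 else 0)"
  using R_orthogonal[OF assms]
  by (auto simp: orthogonal_matrix_orthonormal_columns orthogonal_def dot_square_norm)

lemma V_spanning:
  assumes t: "t \<in> I" and v: "\<And>a. v \<bullet> V a t = 0"
  shows "v = 0"
proof -
  have "v \<bullet> column 1 (R t) = 0"
    using v[of 1] by (simp add: V_1)
  moreover from this have "v \<bullet> column 2 (R t) = 0"
    using v[of 2] U_diagonal(1)[OF t] by (simp add: V_2 inner_add_right)
  moreover from calculation have "v \<bullet> column 3 (R t) = 0"
    using v[of 3] U_diagonal(2)[OF t] by (simp add: V_3 inner_add_right)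
  ultimately have "\<forall>k. v \<bullet> column k (R t) = 0"
    by (simp add: forall_3)
  then have "transpose (R t) *v v = 0"
    by (simp add: vec_eq_iff matrix_vector_mult_def transpose_def column_def inner_vec_def mult.commute)
  have "v = (R t ** transpose (R t)) *v v"
    using R_orthogonal[OF t] by (simp add: orthogonal_matrix_def)
  also have "\<dots> = R t *v (transpose (R t) *v v)"
    by (rule matrix_vector_mul_assoc[symmetric])
  also have "\<dots> = 0"
    unfolding \<open>transpose (R t) *v v = 0\<close> by simp
  finally show ?thesis .
qed

lemma column_differentiable:
  assumes "t \<in> I"
  shows "(\<lambda>s. column j (A s)) differentiable (at t)" "(\<lambda>s. column k (R s)) differentiable (at t)"
  using A_differentiable[OF assms] R_differentiable[OF assms]
    bounded_linear.has_derivative[OF bounded_linear_column]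
  unfolding differentiable_def by blast+

text \<open>Only \<open>A\<close> and \<open>R\<close> are given as differentiable; the entries of the triangular factor inherit this as
  inner products of columns of \<open>R\<close> and \<open>A\<close>.\<close>

lemma b11_differentiable:
  assumes t: "t \<in> I"
  shows "b11 differentiable (at t)"
proof (rule differentiable_transform_open[OF _ open_I t])
  show "(\<lambda>s. column 1 (R s) \<bullet> column 1 (A s)) differentiable (at t)"
    by (intro differentiable_inner column_differentiable t)
  show "column 1 (R s) \<bullet> column 1 (A s) = b11 s" if "s \<in> I" for s
    by (simp add: column_A[OF that] R_columns[OF that] V_1 dir_def factor_def slope_def offset_def)
qed

lemma l1_differentiable:
  assumes t: "t \<in> I"
  shows "l1 differentiable (at t)"
proof (rule differentiable_transform_open[OF _ open_I t])
  show "(\<lambda>s. (column 1 (R s) \<bullet> column 6 (A s)) / b11 s) differentiable (at t)"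
    by (intro differentiable_divide differentiable_inner column_differentiable b11_differentiable t
        nonzero(1))
  show "(column 1 (R s) \<bullet> column 6 (A s)) / b11 s = l1 s" if "s \<in> I" for s
    using nonzero(1)[OF that]
    by (simp add: column_A[OF that] R_columns[OF that] V_1 dir_def factor_def slope_def offset_def)
qed

lemma V_differentiable:
  assumes t: "t \<in> I"
  shows "V a differentiable (at t)"
proof -
  have "\<forall>a. \<exists>j. dir j = a"
    unfolding forall_3
  proof (intro conjI)
    show "\<exists>j. dir j = 1" by (rule exI[of _ 1]) (simp add: dir_def)
    show "\<exists>j. dir j = 2" by (rule exI[of _ 2]) (simp add: dir_def)
    show "\<exists>j. dir j = 3" by (rule exI[of _ 3]) (simp add: dir_def)
  qed
  then obtain j where j: "dir j = a"
    by blast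
  show ?thesis
  proof (rule differentiable_transform_open[OF _ open_I t])
    show "(\<lambda>s. (1 / (b11 s * factor j s)) *\<^sub>R column j (A s)) differentiable (at t)"
      unfolding factor_def using factor_nonzero[OF t, of j, unfolded factor_def] nonzero(1)[OF t]
      by (intro differentiable_scaleR differentiable_divide differentiable_mult differentiable_add
          differentiable_const column_differentiable b11_differentiable l1_differentiable t) simp
    show "(1 / (b11 s * factor j s)) *\<^sub>R column j (A s) = V a s" if "s \<in> I" for s
      using factor_nonzero[OF that, of j] nonzero(1)[OF that] by (simp add: column_A[OF that] j)
  qed
qed

lemma has_vector_derivative_V: "t \<in> I \<Longrightarrow> (V a has_vector_derivative V' a t) (at t)"
  using V_differentiable by (simp add: V'_def vector_derivative_works)

lemma l1_has_derivative: "t \<in> I \<Longrightarrow> (l1 has_real_derivative deriv l1 t) (at t)"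
  using l1_differentiable DERIV_deriv_iff_real_differentiable by blast

lemma column_derivative:
  assumes t: "t \<in> I"
  shows "vector_derivative (\<lambda>s. column j (A s)) (at t) =
    (deriv b11 t * factor j t + b11 t * slope j * deriv l1 t) *\<^sub>R V (dir j) t
    + (b11 t * factor j t) *\<^sub>R V' (dir j) t"
proof (rule vector_derivative_at)
  have b: "(b11 has_real_derivative deriv b11 t) (at t)"
    using b11_differentiable[OF t] DERIV_deriv_iff_real_differentiable by blast
  have "((\<lambda>s. b11 s * factor j s) has_real_derivative
      deriv b11 t * factor j t + b11 t * slope j * deriv l1 t) (at t)"
    unfolding factor_def
    by (auto intro!: derivative_eq_intros b l1_has_derivative t simp: algebra_simps)
  then have "((\<lambda>s. (b11 s * factor j s) *\<^sub>R V (dir j) s) has_vector_derivative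
      (b11 t * factor j t) *\<^sub>R V' (dir j) t
      + (deriv b11 t * factor j t + b11 t * slope j * deriv l1 t) *\<^sub>R V (dir j) t) (at t)"
    by (rule has_vector_derivative_scaleR[OF _ has_vector_derivative_V[OF t]])
  then show "((\<lambda>s. column j (A s)) has_vector_derivative
      (deriv b11 t * factor j t + b11 t * slope j * deriv l1 t) *\<^sub>R V (dir j) t
      + (b11 t * factor j t) *\<^sub>R V' (dir j) t) (at t)"
    using has_vector_derivative_transform_within_open[OF _ open_I t] column_A
    by (metis (no_types, lifting) add.commute)
qed

text \<open>The terms with \<open>deriv b11\<close> cancel by antisymmetry, and the Wronskian of two affine functions of \<open>l1\<close>
  is \<open>deriv l1\<close> times the determinant of their coefficients.\<close>

lemma Q_eq:
  assumes t: "t \<in> I"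
  shows "Q A i j t = factor i t * factor j t * twist (dir i) (dir j) t
    + bracket i j * pairing (dir i) (dir j) t"
  unfolding Q_def column_derivative[OF t] column_A[OF t] twist_def pairing_def bracket_def factor_def
  by (simp add: inner_add_left inner_commute[of "V (dir j) t"] algebra_simps power2_eq_square)

section \<open>Rigidity\<close>

text \<open>Columns \<open>i, k\<close> on one line and \<open>j, l\<close> on another, where \<open>k\<close> and \<open>j\<close> carry the same factor \<open>\<beta>\<close>. The
  pair \<open>k, j\<close> has zero bracket and is one of the unconstrained pairs (1,4), (2,5), (3,6) up to
  order; the other three give the equations of \<open>bracket_triple_rigid\<close>.\<close>

lemma crossing_columns_rigid:
  assumes x': "\<And>t. t \<in> I \<Longrightarrow> deriv l1 t \<noteq> 0"
    and d: "dir i = a" "dir k = a" "dir j = b" "dir l = b"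
    and jk: "slope k = slope j" "offset k = offset j"
    and nz: "bracket i j \<noteq> 0" "bracket j l \<noteq> 0" "bracket i l \<noteq> 0"
    and Q: "Q A i j constant_on I" "Q A k l constant_on I" "Q A i l constant_on I"
  shows "\<And>t. t \<in> I \<Longrightarrow> twist a b t = 0" "pairing a b constant_on I"
proof -
  obtain c12 c23 c13 where c: "\<And>t. t \<in> I \<Longrightarrow> Q A i j t = c12" "\<And>t. t \<in> I \<Longrightarrow> Q A k l t = c23"
    "\<And>t. t \<in> I \<Longrightarrow> Q A i l t = c13"
    using Q unfolding constant_on_def by blast
  note concl = bracket_triple_rigid[OF open_I l1_has_derivative x' factor_nonzero[unfolded factor_def]
      factor_nonzero[unfolded factor_def] nz[unfolded bracket_def]]
  show "twist a b t = 0" if "t \<in> I" for t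
    by (rule concl(1)[OF _ _ _ _ _ _ _ that]) (use c Q_eq d jk in \<open>simp_all add: bracket_def factor_def\<close>)
  show "pairing a b constant_on I"
    by (rule concl(2)) (use c Q_eq d jk in \<open>simp_all add: bracket_def factor_def\<close>)
qed

lemma V_constant:
  assumes c: "c \<noteq> 0" "\<And>t. t \<in> I \<Longrightarrow> (b11 t)\<^sup>2 * deriv l1 t = c"
    and tw: "\<And>a b t. t \<in> I \<Longrightarrow> twist a b t = 0"
    and pr: "\<And>a b. pairing a b constant_on I"
  shows "V a constant_on I"
proof (rule constant_on_if_derivative_zero[OF convex_I])
  fix t assume t: "t \<in> I"
  have "V' a t \<bullet> V b t = 0" for b
  proof -
    obtain d where "\<And>s. s \<in> I \<Longrightarrow> pairing a b s = d"
      using pr[of a b] by (auto simp: constant_on_def)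
    then have "c * (V a s \<bullet> V b s) = d" if "s \<in> I" for s
      using that by (simp add: pairing_def c(2))
    then have "(\<lambda>s. V a s \<bullet> V b s) constant_on I"
      using c(1) by (intro constant_onI[where c = "d / c"]) (simp add: field_simps)
    then have "((\<lambda>s. V a s \<bullet> V b s) has_vector_derivative 0) (at t)"
      by (rule derivative_zero_if_constant_on[OF open_I t])
    moreover have "((\<lambda>s. V a s \<bullet> V b s) has_vector_derivative
        V a t \<bullet> V' b t + V' a t \<bullet> V b t) (at t)"
      using bounded_bilinear.has_vector_derivative[OF bounded_bilinear_inner
          has_vector_derivative_V[OF t] has_vector_derivative_V[OF t]] .
    ultimately have "V a t \<bullet> V' b t + V' a t \<bullet> V b t = 0"
      using vector_derivative_unique_at by blast
    moreover have "V' a t \<bullet> V b t = V' b t \<bullet> V a t"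
      using tw[OF t, of a b] nonzero(1)[OF t] by (simp add: twist_def)
    ultimately show ?thesis
      by (simp add: inner_commute)
  qed
  then have "V' a t = 0"
    using V_spanning[OF t] by blast
  then show "(V a has_vector_derivative 0) (at t)"
    using has_vector_derivative_V[OF t, of a] by simp
qed

text \<open>Gram-Schmidt on the constant vectors \<open>V 1, V 2, V 3\<close>: each off-diagonal entry of \<open>U\<close> is an inner
  product of a \<open>V a\<close> with a column of \<open>R\<close> already known to be constant, and each new column of \<open>R\<close> is
  the direction of the remainder.\<close>

lemma QR_factors_constant:
  assumes V: "\<And>a. V a constant_on I"
  shows "R constant_on I" "\<And>i j. (\<lambda>t. U t $ i $ j) constant_on I"
proof -
  obtain v where v: "\<And>a t. t \<in> I \<Longrightarrow> V a t = v a"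
    using V unfolding constant_on_def by metis
  have norm_R: "norm (column k (R t)) = 1" if "t \<in> I" for k t
    using R_columns[OF that, of k k] by (simp add: norm_eq_1)
  note unit = unit_direction_constant[OF open_I convex_I column_differentiable(2) norm_R]
  have r1: "column 1 (R t) = v 1" if "t \<in> I" for t
    using v[OF that, of 1] by (simp add: V_1)
  have u12: "U t $ 1 $ 2 = v 1 \<bullet> v 2" if "t \<in> I" for t
    using R_columns[OF that] by (simp add: v[OF that, symmetric] V_1 V_2 inner_add_right)
  have e2: "U t $ 2 $ 2 *\<^sub>R column 2 (R t) = v 2 - (v 1 \<bullet> v 2) *\<^sub>R v 1" if "t \<in> I" for t
    using V_2[of t] v[OF that] r1[OF that] u12[OF that] by (simp add: algebra_simps)
  obtain k2 r2 where k2: "\<And>t. t \<in> I \<Longrightarrow> U t $ 2 $ 2 = k2"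
    and r2: "\<And>t. t \<in> I \<Longrightarrow> column 2 (R t) = r2"
    using unit[OF _ _ U_diagonal(1) e2] unfolding constant_on_def by blast
  have u13: "U t $ 1 $ 3 = v 1 \<bullet> v 3" if "t \<in> I" for t
    using R_columns[OF that] by (simp add: v[OF that, symmetric] V_1 V_3 inner_add_right)
  have u23: "U t $ 2 $ 3 = r2 \<bullet> v 3" if "t \<in> I" for t
    using R_columns[OF that]
    by (simp add: v[OF that, symmetric] r2[OF that, symmetric] V_3 inner_add_right)
  have e3: "U t $ 3 $ 3 *\<^sub>R column 3 (R t)
      = v 3 - (v 1 \<bullet> v 3) *\<^sub>R v 1 - (r2 \<bullet> v 3) *\<^sub>R r2" if "t \<in> I" for t
    using V_3[of t] v[OF that] r1[OF that] r2[OF that] u13[OF that] u23[OF that]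
    by (simp add: algebra_simps)
  obtain k6 r3 where k6: "\<And>t. t \<in> I \<Longrightarrow> U t $ 3 $ 3 = k6"
    and r3: "\<And>t. t \<in> I \<Longrightarrow> column 3 (R t) = r3"
    using unit[OF _ _ U_diagonal(2) e3] unfolding constant_on_def by blast
  have "\<forall>k. \<exists>r. \<forall>t\<in>I. column k (R t) = r"
    using r1 r2 r3 by (auto simp: forall_3)
  then obtain r where r: "\<And>k t. t \<in> I \<Longrightarrow> column k (R t) = r k"
    by metis
  have "R t = (\<chi> i k. r k $ i)" if "t \<in> I" for t
    by (simp add: vec_eq_iff r[OF that, symmetric] column_def)
  then show "R constant_on I"
    by (rule constant_onI)
  have "\<forall>i j. (\<lambda>t. U t $ i $ j) constant_on I"
    using k2 k6 u12 u13 u23 unfolding forall_3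
    by (intro conjI) (auto intro: constant_onI simp: U_def)
  then show "(\<lambda>t. U t $ i $ j) constant_on I" for i j
    by blast
qed

text \<open>In each excluded case two columns on the same line have a constant ratio: columns 5 and 3 if
  \<open>m0 = 0\<close>, columns 2 and 4 if \<open>m1 = 0\<close>, columns 6 and 1 if \<open>l1\<close> is constant.\<close>

lemma parameters_nonzero:
  assumes ind: "columns_independent_on I A"
  shows "m0 \<noteq> 0" "m1 \<noteq> 0" "\<not> l1 constant_on I"
proof -
  have "column 5 (A t) = m1 *\<^sub>R column 3 (A t)" if "t \<in> I" "m0 = 0" for t
    unfolding column_A[OF that(1)] dir_def factor_def slope_def offset_def using that(2) by simp
  then show "m0 \<noteq> 0"
    using proportional_columns_dependent[of 5 3 I A m1] ind by auto
  have "column 2 (A t) = m0 *\<^sub>R column 4 (A t)" if "t \<in> I" "m1 = 0" for t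
    unfolding column_A[OF that(1)] dir_def factor_def slope_def offset_def using that(2) by simp
  then show "m1 \<noteq> 0"
    using proportional_columns_dependent[of 2 4 I A m0] ind by auto
  show "\<not> l1 constant_on I"
  proof
    assume "l1 constant_on I"
    then obtain k where k: "\<And>t. t \<in> I \<Longrightarrow> l1 t = k"
      by (auto simp: constant_on_def)
    have "column 6 (A t) = k *\<^sub>R column 1 (A t)" if "t \<in> I" for t
      using that k by (simp add: column_A dir_def factor_def slope_def offset_def)
    then show False
      using proportional_columns_dependent[of 6 1 I A k] ind by auto
  qed
qed

text \<open>As \<open>V 1\<close> is a unit vector, \<open>Q A 1 6\<close> is \<open>- b11\<^sup>2 * deriv l1\<close>. Being constant, it is zero everywhere as
  soon as it is zero somewhere, and then \<open>l1\<close> would be constant. So \<open>deriv l1\<close> never vanishes.\<close>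

lemma speed_constant:
  assumes ind: "columns_independent_on I A" and Q16: "Q A 1 6 constant_on I"
  obtains c where "c \<noteq> 0" "\<And>t. t \<in> I \<Longrightarrow> (b11 t)\<^sup>2 * deriv l1 t = c"
proof -
  obtain d where "\<And>t. t \<in> I \<Longrightarrow> Q A 1 6 t = d"
    using Q16 by (auto simp: constant_on_def)
  then have c: "(b11 t)\<^sup>2 * deriv l1 t = - d" if "t \<in> I" for t
    using Q_eq[OF that, of 1 6] R_columns[OF that, of 1 1] that
    by (simp add: twist_def pairing_def dir_def V_1 bracket_def slope_def offset_def)
  have "d \<noteq> 0"
  proof
    assume "d = 0"
    then have "(l1 has_vector_derivative 0) (at t)" if "t \<in> I" for t
      using c[OF that] nonzero(1)[OF that] l1_has_derivative[OF that]
      by (simp add: has_real_derivative_iff_has_vector_derivative)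
    then show False
      using constant_on_if_derivative_zero[OF convex_I] parameters_nonzero(3)[OF ind] by blast
  qed
  then show ?thesis
    using c that[of "- d"] by simp
qed

lemma constant_frame:
  assumes ind: "columns_independent_on I A"
    and Q: "\<forall>(i, j) \<in> constrained_pairs. Q A i j constant_on I"
  shows "V a constant_on I"
proof -
  have Qc: "Q A i j constant_on I" if "(i, j) \<in> constrained_pairs \<or> (j, i) \<in> constrained_pairs" for i j
  proof -
    have "Q A i j constant_on I \<or> Q A j i constant_on I"
      using Q that by blast
    moreover have "Q A i j = (\<lambda>t. - Q A j i t)"
      using Q_antisym[of A i j] by blast
    ultimately show ?thesis
      by (auto simp: constant_on_def)
  qed
  note m = parameters_nonzero[OF ind]
  note data = dir_def bracket_def slope_def offset_def
  have "Q A 1 6 constant_on I"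
    by (rule Qc) (simp add: constrained_pairs_def)
  then obtain c where c: "c \<noteq> 0" "\<And>t. t \<in> I \<Longrightarrow> (b11 t)\<^sup>2 * deriv l1 t = c"
    using speed_constant[OF ind] by metis
  have x': "deriv l1 t \<noteq> 0" if "t \<in> I" for t
    using c(1) c(2)[OF that] by auto
  \<comment> \<open>The transitive orderings of the factors are \<open>x, 1, w\<close> for directions 1 and 2; \<open>1, x, w\<close> for
    directions 1 and 3; \<open>1, w, x\<close> for directions 2 and 3.\<close>
  have Q12: "Q A 6 4 constant_on I" "Q A 1 2 constant_on I" "Q A 6 2 constant_on I"
    by (rule Qc, simp add: constrained_pairs_def)+
  have 12: "\<And>t. t \<in> I \<Longrightarrow> twist 1 2 t = 0" "pairing 1 2 constant_on I"
    using m by (intro crossing_columns_rigid[OF x' _ _ _ _ _ _ _ _ _ Q12]; simp add: data)+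
  have Q13: "Q A 1 3 constant_on I" "Q A 6 5 constant_on I" "Q A 1 5 constant_on I"
    by (rule Qc, simp add: constrained_pairs_def)+
  have 13: "\<And>t. t \<in> I \<Longrightarrow> twist 1 3 t = 0" "pairing 1 3 constant_on I"
    using m by (intro crossing_columns_rigid[OF x' _ _ _ _ _ _ _ _ _ Q13]; simp add: data)+
  have Q23: "Q A 4 5 constant_on I" "Q A 2 3 constant_on I" "Q A 4 3 constant_on I"
    by (rule Qc, simp add: constrained_pairs_def)+
  have 23: "\<And>t. t \<in> I \<Longrightarrow> twist 2 3 t = 0" "pairing 2 3 constant_on I"
    using m by (intro crossing_columns_rigid[OF x' _ _ _ _ _ _ _ _ _ Q23]; simp add: data)+
  have diag: "pairing a a constant_on I"
    if "(i, j) \<in> constrained_pairs" "dir i = a" "dir j = a" "bracket i j \<noteq> 0" for a i j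
  proof -
    have "Q A i j constant_on I"
      using Qc that(1) by blast
    then obtain d where "\<And>t. t \<in> I \<Longrightarrow> Q A i j t = d"
      by (auto simp: constant_on_def)
    then have "bracket i j * pairing a a t = d" if "t \<in> I" for t
      using Q_eq[OF that, of i j] that \<open>dir i = a\<close> \<open>dir j = a\<close> by (simp add: twist_def)
    then show ?thesis
      using that(4) by (intro constant_onI[where c = "d / bracket i j"]) (simp add: field_simps)
  qed
  have p11: "pairing 1 1 constant_on I"
    by (rule diag[of 1 6]) (use m in \<open>simp_all add: data constrained_pairs_def\<close>)
  have p22: "pairing 2 2 constant_on I"
    by (rule diag[of 2 4]) (use m in \<open>simp_all add: data constrained_pairs_def\<close>)
  have p33: "pairing 3 3 constant_on I"
    by (rule diag[of 3 5]) (use m in \<open>simp_all add: data constrained_pairs_def\<close>)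
  have tw_swap: "twist b a t = - twist a b t" for a b t
    by (simp add: twist_def algebra_simps)
  have tw: "twist a b t = 0" if "t \<in> I" for a b t
    using exhaust_3[of a] exhaust_3[of b] 12(1)[OF that] 13(1)[OF that] 23(1)[OF that]
      tw_swap[of 1 1 t] tw_swap[of 2 2 t] tw_swap[of 3 3 t]
      tw_swap[of 2 1 t] tw_swap[of 3 1 t] tw_swap[of 3 2 t]
    by auto
  have pr_swap: "pairing b a = pairing a b" for a b
    by (simp add: pairing_def inner_commute fun_eq_iff)
  have pr: "pairing a b constant_on I" for a b
    using exhaust_3[of a] exhaust_3[of b] p11 p22 p33 12(2) 13(2) 23(2)
      pr_swap[of 2 1] pr_swap[of 3 1] pr_swap[of 3 2]
    by auto
  show ?thesis
    by (rule V_constant[OF c tw pr])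
qed

lemma constraints_imp_solution:
  assumes ind: "columns_independent_on I A"
    and Q: "\<forall>(i, j) \<in> constrained_pairs. Q A i j constant_on I"
  shows "R constant_on I \<and>
      (\<exists>k0 k1 k2 k3 k4 k5 :: real.
         k0 \<noteq> 0 \<and> k1 \<noteq> 0 \<and> k2 \<noteq> 0 \<and> m0 \<noteq> 0 \<and> m1 \<noteq> 0 \<and>
         (\<forall>t\<in>I.
            (deriv l1 t)^3 = k0 * (l1 t)^2 * (m1 * l1 t + m0)^2 \<and>
            l2 t = 1 / (m1 * l1 t + m0) \<and>
            (b11 t)^3 = k1 / (l1 t * (m1 * l1 t + m0)) \<and>
            b22 t = k2 * b11 t * (m1 * l1 t + m0) \<and>
            b12 t = k3 * b11 t * (m1 * l1 t + m0) \<and>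
            b13 t = k4 * b11 t * l1 t \<and>
            b23 t = k5 * b11 t * l1 t))"
proof -
  note RU = QR_factors_constant[OF constant_frame[OF ind Q]]
  have "Q A 1 6 constant_on I"
    using Q by (auto simp: constrained_pairs_def)
  then obtain c where c: "c \<noteq> 0" "\<And>t. t \<in> I \<Longrightarrow> (b11 t)\<^sup>2 * deriv l1 t = c"
    using speed_constant[OF ind] by metis
  obtain u where u: "\<And>i j t. t \<in> I \<Longrightarrow> U t $ i $ j = u i j"
    using RU(2) unfolding constant_on_def by metis
  have "I \<noteq> {}"
    using parameters_nonzero(3)[OF ind] by (auto simp: constant_on_def)
  then have u_nz: "u 2 2 \<noteq> 0" "u 3 3 \<noteq> 0"
    using U_diagonal u by force+
  define k1 where "k1 = 1 / (u 2 2 * u 3 3)"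
  have k1: "k1 \<noteq> 0"
    using u_nz by (simp add: k1_def)
  have eqs: "(deriv l1 t)^3 = c^3 / k1\<^sup>2 * (l1 t)^2 * (m1 * l1 t + m0)^2 \<and>
      l2 t = 1 / (m1 * l1 t + m0) \<and>
      (b11 t)^3 = k1 / (l1 t * (m1 * l1 t + m0)) \<and>
      b22 t = u 2 2 * b11 t * (m1 * l1 t + m0) \<and>
      b12 t = u 1 2 * b11 t * (m1 * l1 t + m0) \<and>
      b13 t = u 1 3 * b11 t * l1 t \<and>
      b23 t = u 2 3 * b11 t * l1 t" if t: "t \<in> I" for t
  proof -
    note nz = nonzero(1-3)[OF t] w_nonzero[OF t]
    define w where "w = m1 * l1 t + m0"
    have w: "w \<noteq> 0"
      using nz by (simp add: w_def)
    have b22: "b22 t = u 2 2 * b11 t * w" and "b12 t = u 1 2 * b11 t * w"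
      and "b13 t = u 1 3 * b11 t * l1 t" and "b23 t = u 2 3 * b11 t * l1 t"
      using nz w by (simp_all add: u[OF t, symmetric] U_def w_def)
    have "u 3 3 * ((b11 t)\<^sup>2 * b22 t * l1 t) = 1"
      using nz by (simp add: u[OF t, symmetric] U_def)
    then have "u 2 2 * u 3 3 * ((b11 t)^3 * (l1 t * w)) = 1"
      unfolding b22 by (simp add: algebra_simps power2_eq_square power3_eq_cube)
    then have k: "(b11 t)^3 * (l1 t * w) = k1"
      using u_nz by (simp add: k1_def field_simps)
    \<comment> \<open>Cube \<open>c = b11\<^sup>2 * deriv l1\<close> and replace \<open>b11^6\<close> by means of \<open>k\<close>.\<close>
    have "(deriv l1 t)^3 * k1\<^sup>2 = c^3 * (l1 t)\<^sup>2 * w\<^sup>2"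
      unfolding k[symmetric] c(2)[OF t, symmetric] by algebra
    then have "(deriv l1 t)^3 = c^3 / k1\<^sup>2 * (l1 t)\<^sup>2 * w\<^sup>2"
      using k1 by (simp add: field_simps)
    moreover have "(b11 t)^3 = k1 / (l1 t * w)"
      using k nz w by (simp add: field_simps)
    ultimately show ?thesis
      using \<open>b12 t = _\<close> \<open>b13 t = _\<close> \<open>b23 t = _\<close> b22 l2_eq[OF t] unfolding w_def by blast
  qed
  moreover have "c^3 / k1\<^sup>2 \<noteq> 0"
    using c(1) k1 by simp
  ultimately show ?thesis
    using RU(1) k1 u_nz(1) parameters_nonzero(1,2)[OF ind] by blast
qed

section \<open>The converse\<close>

text \<open>The equations for \<open>b11\<close> and \<open>b22\<close> determine the last diagonal entry of \<open>U\<close> as \<open>1 / (k1 * k2)\<close>, and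
  those for \<open>deriv l1\<close> and \<open>b11\<close> give the cube of \<open>b11\<^sup>2 * deriv l1\<close>; real cube roots are unique.\<close>

lemma solution_imp_constraints:
  assumes R: "R constant_on I"
    and k: "k1 \<noteq> 0" "k2 \<noteq> 0"
    and eqs: "\<And>t. t \<in> I \<Longrightarrow>
            (deriv l1 t)^3 = k0 * (l1 t)^2 * (m1 * l1 t + m0)^2 \<and>
            l2 t = 1 / (m1 * l1 t + m0) \<and>
            (b11 t)^3 = k1 / (l1 t * (m1 * l1 t + m0)) \<and>
            b22 t = k2 * b11 t * (m1 * l1 t + m0) \<and>
            b12 t = k3 * b11 t * (m1 * l1 t + m0) \<and>
            b13 t = k4 * b11 t * l1 t \<and>
            b23 t = k5 * b11 t * l1 t"
  shows "Q A i j constant_on I"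
proof -
  obtain R0 where R0: "\<And>t. t \<in> I \<Longrightarrow> R t = R0"
    using R by (auto simp: constant_on_def)
  define U0 :: "real^3^3" where
    "U0 = vector [vector [1, k3, k4], vector [0, k2, k5], vector [0, 0, 1 / (k1 * k2)]]"
  have prod: "(b11 t)^3 * (l1 t * (m1 * l1 t + m0)) = k1" if "t \<in> I" for t
    using eqs[OF that] nonzero(3)[OF that] w_nonzero[OF that] by simp
  have U0: "U t = U0" if t: "t \<in> I" for t
  proof -
    have p: "(b11 t)\<^sup>2 * b22 t * l1 t = k1 * k2"
      unfolding prod[OF t, symmetric] eqs[OF t, THEN conjunct2, THEN conjunct2, THEN conjunct2, THEN conjunct1]
      by algebra
    show ?thesis
      unfolding U_def U0_def p using eqs[OF t] nonzero(1,3)[OF t] w_nonzero[OF t] by simp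
  qed
  have V0: "V a t = column a (R0 ** U0)" if "t \<in> I" for a t
    using that by (simp add: V_def R0 U0)
  have tw: "twist a b t = 0" if t: "t \<in> I" for a b t
  proof -
    have "V' a t = 0" for a
      unfolding V'_def
      by (rule vector_derivative_at[OF derivative_zero_if_constant_on[OF open_I t constant_onI[OF V0]]])
    then show ?thesis
      by (simp add: twist_def)
  qed
  have speed: "(b11 t)\<^sup>2 * deriv l1 t = root 3 (k0 * k1\<^sup>2)" if t: "t \<in> I" for t
  proof -
    have "((b11 t)\<^sup>2 * deriv l1 t)^3 = ((b11 t)^3)\<^sup>2 * (deriv l1 t)^3"
      by algebra
    also have "\<dots> = k0 * k1\<^sup>2"
      unfolding prod[OF t, symmetric] using eqs[OF t] by algebra
    finally show ?thesis
      by (metis odd_numeral odd_real_root_power_cancel)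
  qed
  show ?thesis
    by (rule constant_onI) (simp add: Q_eq tw pairing_def speed V0)
qed

end

theorem theorem6p4:
  fixes I :: "real set"
    and A :: "real \<Rightarrow> real^6^3"
    and R :: "real \<Rightarrow> real^3^3"
    and b11 b12 b13 b22 b23 l1 l2 :: "real \<Rightarrow> real"
    and m0 m1 :: real
  assumes "open I" and "is_interval I"
    and "smooth_on I A" and "smooth_on I R"
    and "columns_independent_on I A"
    and "\<forall>t\<in>I. rotation_matrix (R t)"
    and "\<forall>t\<in>I. A t = R t ** B_matrix (b11 t) (b12 t) (b13 t) (b22 t) (b23 t) (l1 t) (l2 t)"
    and "\<forall>t\<in>I. b11 t \<noteq> 0 \<and> b22 t \<noteq> 0 \<and> l1 t \<noteq> 0 \<and> l2 t \<noteq> 0"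
  shows
    "((\<forall>(i, j) \<in> constrained_pairs. Q A i j constant_on I) \<and>
      (\<forall>t\<in>I. l2 t = 1 / (m1 * l1 t + m0))
      \<longrightarrow>
      R constant_on I \<and>
      (\<exists>k0 k1 k2 k3 k4 k5 :: real.
         k0 \<noteq> 0 \<and> k1 \<noteq> 0 \<and> k2 \<noteq> 0 \<and> m0 \<noteq> 0 \<and> m1 \<noteq> 0 \<and>
         (\<forall>t\<in>I.
            (deriv l1 t)^3 = k0 * (l1 t)^2 * (m1 * l1 t + m0)^2 \<and>
            l2 t = 1 / (m1 * l1 t + m0) \<and>
            (b11 t)^3 = k1 / (l1 t * (m1 * l1 t + m0)) \<and>
            b22 t = k2 * b11 t * (m1 * l1 t + m0) \<and>
            b12 t = k3 * b11 t * (m1 * l1 t + m0) \<and>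
            b13 t = k4 * b11 t * l1 t \<and>
            b23 t = k5 * b11 t * l1 t)))
     \<and>
     (R constant_on I \<and>
      (\<exists>k0 k1 k2 k3 k4 k5 :: real.
         k0 \<noteq> 0 \<and> k1 \<noteq> 0 \<and> k2 \<noteq> 0 \<and> m0 \<noteq> 0 \<and> m1 \<noteq> 0 \<and>
         (\<forall>t\<in>I.
            (deriv l1 t)^3 = k0 * (l1 t)^2 * (m1 * l1 t + m0)^2 \<and>
            l2 t = 1 / (m1 * l1 t + m0) \<and>
            (b11 t)^3 = k1 / (l1 t * (m1 * l1 t + m0)) \<and>
            b22 t = k2 * b11 t * (m1 * l1 t + m0) \<and>
            b12 t = k3 * b11 t * (m1 * l1 t + m0) \<and>
            b13 t = k4 * b11 t * l1 t \<and>
            b23 t = k5 * b11 t * l1 t))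
      \<longrightarrow>
      (\<forall>(i, j) \<in> constrained_pairs. Q A i j constant_on I))"
proof -
  have frame: "factored_solution I A R b11 b12 b13 b22 b23 l1 l2 m0 m1"
    if "\<forall>t\<in>I. l2 t = 1 / (m1 * l1 t + m0)"
  proof
    show "A differentiable (at t)" "R differentiable (at t)" if "t \<in> I" for t
      using assms(3,4) that unfolding smooth_on_def by (metis funpow_0)+
  qed (use assms that is_interval_convex in \<open>auto simp: rotation_matrix_def\<close>)
  show ?thesis (is "(?cs \<and> ?l \<longrightarrow> ?sol) \<and> (?sol \<longrightarrow> ?cs)")
  proof (rule conjI; rule impI)
    assume h: "?cs \<and> ?l"
    show ?sol
      by (rule factored_solution.constraints_imp_solution[OF frame[OF conjunct2[OF h]] assms(5) conjunct1[OF h]])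
  next
    assume ?sol
    then obtain k0 k1 k2 k3 k4 k5 where R: "R constant_on I" and k: "k1 \<noteq> 0" "k2 \<noteq> 0"
      and eqs: "\<forall>t\<in>I.
            (deriv l1 t)^3 = k0 * (l1 t)^2 * (m1 * l1 t + m0)^2 \<and>
            l2 t = 1 / (m1 * l1 t + m0) \<and>
            (b11 t)^3 = k1 / (l1 t * (m1 * l1 t + m0)) \<and>
            b22 t = k2 * b11 t * (m1 * l1 t + m0) \<and>
            b12 t = k3 * b11 t * (m1 * l1 t + m0) \<and>
            b13 t = k4 * b11 t * l1 t \<and>
            b23 t = k5 * b11 t * l1 t"
      by (elim conjE exE)
    have "\<forall>t\<in>I. l2 t = 1 / (m1 * l1 t + m0)"
      using eqs by simp
    then have "Q A i j constant_on I" for i j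
      by (rule factored_solution.solution_imp_constraints[OF frame R k bspec[OF eqs]])
    then show ?cs
      by (simp add: case_prod_beta)
  qed
qed

end
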